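(* Let $m,n,k$ be positive integers with $2\le k\le \min\{m,n\}$. The set $\mathcal{M}_{m,n;k}$ of maximal $I_k$-avoiding $(0,1)$-matrices of size $m\times n$ is in bijection with the set of plane partitions of size $(m-k+1)\times(n-k+1)\times(k-1)$. Therefore $$|\mathcal{M}_{m,n;k}| = H(m-k+1,\,n-k+1,\,k-1).$$
   Context: A $(0,1)$-matrix $M$ of size $m\times n$ contains $I_k$ (the $k\times k$ identity matrix) if there are rows $r_1<\dots<r_k$ and columns $c_1<\dots<c_k$ with $M_{r_i,c_i}=1$ for all $i=1,\dots,k$ (the other entries $M_{r_i,c_j}$, $i\neq j$, are arbitrary). $M$ is $I_k$-avoiding if it does not contain $I_k$. An $I_k$-avoiding $M$ is maximal if it has the maximum possible number of $1$'s among all $I_k$-avoiding $m\times n$ $(0,1)$-matrices. $\mathcal{M}_{m,n;k}$ is the set of all maximal $I_k$-avoiding $m\times n$ $(0,1)$-matrices. A plane partition of size $a\times b\times c$ is an $a\times b$ array $\pi=(\pi_{i,j})$ of integers with $0\le \pi_{i,j}\le c$, $\pi_{i,j}\ge\pi_{i+1,j}$ and $\pi_{i,j}\ge\pi_{i,j+1}$. For nonnegative integers $a,b,c$, $$H(a,b,c)=\prod_{i=1}^{a}\prod_{j=1}^{b}\prod_{\ell=1}^{c}\frac{i+j+\ell-1}{i+j+\ell-2},$$ with empty products equal to $1$. *)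

theory Defs
  imports Complex_Main "Jordan_Normal_Form.Matrix"
begin

text \<open>Rows and columns of matrices are indexed from 0, so the index set of an
  \<open>m \<times> n\<close> matrix is \<open>{..<m} \<times> {..<n}\<close>.\<close>

definition zero_one_matrices :: "nat \<Rightarrow> nat \<Rightarrow> int mat set" where
  "zero_one_matrices m n =
     {M \<in> carrier_mat m n. \<forall>i<m. \<forall>j<n. M $$ (i, j) \<in> {0, 1}}"

definition contains_identity :: "nat \<Rightarrow> int mat \<Rightarrow> bool" where
  "contains_identity k M \<longleftrightarrow>
     (\<exists>r c :: nat \<Rightarrow> nat.
        strict_mono_on {..<k} r \<and> strict_mono_on {..<k} c \<and>
        (\<forall>i<k. r i < dim_row M \<and> c i < dim_col M \<and> M $$ (r i, c i) = 1))"

definition avoiding_matrices :: "nat \<Rightarrow> nat \<Rightarrow> nat \<Rightarrow> int mat set" where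
  "avoiding_matrices m n k = {M \<in> zero_one_matrices m n. \<not> contains_identity k M}"

definition num_ones :: "int mat \<Rightarrow> nat" where
  "num_ones M = card {(i, j). i < dim_row M \<and> j < dim_col M \<and> M $$ (i, j) = 1}"

text \<open>Maximality refers to the number of ones, not to inclusion of supports.\<close>

definition maximal_avoiding_matrices :: "nat \<Rightarrow> nat \<Rightarrow> nat \<Rightarrow> int mat set" where
  "maximal_avoiding_matrices m n k =
     {M \<in> avoiding_matrices m n k. \<forall>N \<in> avoiding_matrices m n k. num_ones N \<le> num_ones M}"

definition plane_partitions :: "nat \<Rightarrow> nat \<Rightarrow> nat \<Rightarrow> int mat set" where
  "plane_partitions a b c =
     {P \<in> carrier_mat a b.
        (\<forall>i<a. \<forall>j<b. 0 \<le> P $$ (i, j) \<and> P $$ (i, j) \<le> int c) \<and>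
        (\<forall>i j. i + 1 < a \<and> j < b \<longrightarrow> P $$ (i, j) \<ge> P $$ (i + 1, j)) \<and>
        (\<forall>i j. i < a \<and> j + 1 < b \<longrightarrow> P $$ (i, j) \<ge> P $$ (i, j + 1))}"

definition H :: "nat \<Rightarrow> nat \<Rightarrow> nat \<Rightarrow> real" where
  "H a b c = (\<Prod>i=1..a. \<Prod>j=1..b. \<Prod>l=1..c.
     (real i + real j + real l - 1) / (real i + real j + real l - 2))"

end

theory Submission
  imports Defs "Jordan_Normal_Form.Determinant"
begin

text \<open>Write \<open>k = c + 1\<close>, \<open>m = a + c\<close>, \<open>n = b + c\<close>. The complement \<open>w = c - \<pi>\<close> of a plane partition
  \<open>\<pi>\<close> increases weakly along rows and columns, and the matrix attached to \<open>\<pi>\<close> has its zeros exactly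
  at the cells \<open>(x + w x y, y + w x y)\<close> of the \<open>a \<times> b\<close> box pushed down their diagonals. A fixed-point
  argument shows that this matrix avoids \<open>I_k\<close>. Conversely, if \<open>M\<close> avoids \<open>I_k\<close>, let \<open>w x y\<close> be the
  least \<open>t\<close> such that the rows up to \<open>x + t\<close> and columns up to \<open>y + t\<close> contain no chain of \<open>t + 1\<close>
  ones; this \<open>w\<close> is monotone and its \<open>ab\<close> pushed cells are zeros of \<open>M\<close>. Hence the maximal matrices are
  those with exactly \<open>ab\<close> zeros, and they correspond to the plane partitions.

  For MacMahon's formula, a plane partition is completed by constant regions to a Gelfand-Tsetlin
  pattern with top row \<open>(c^a, 0^b)\<close>. The number of patterns with a given shifted top row \<open>x\<close> is
  the determinant of the binomial coefficients \<open>x_i choose j\<close>: summing over the next row telescopes in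
  each row of the determinant. Expanding the binomials in the Newton basis at the nodes \<open>x_i\<close> makes the
  matrix triangular and gives the product of the \<open>(x_i - x_l) / (i - l)\<close>.\<close>

section \<open>Maximal avoiding matrices and plane partitions\<close>

text \<open>Forcing the value 0 off the box makes arrays with the same entries equal as functions,
  as the bijections need.\<close>

definition height_arrays :: "nat \<Rightarrow> nat \<Rightarrow> nat \<Rightarrow> (nat \<Rightarrow> nat \<Rightarrow> nat) set" where
  "height_arrays a b c = {w.
     (\<forall>x y. x < a \<longrightarrow> y < b \<longrightarrow> w x y \<le> c) \<and>
     (\<forall>x y. Suc x < a \<longrightarrow> y < b \<longrightarrow> w x y \<le> w (Suc x) y) \<and>
     (\<forall>x y. x < a \<longrightarrow> Suc y < b \<longrightarrow> w x y \<le> w x (Suc y)) \<and>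
     (\<forall>x y. \<not> (x < a \<and> y < b) \<longrightarrow> w x y = 0)}"

lemma height_arrays_le: "w \<in> height_arrays a b c \<Longrightarrow> w x y \<le> c"
  unfolding height_arrays_def by (cases "x < a \<and> y < b") auto

lemma height_arrays_outside: "w \<in> height_arrays a b c \<Longrightarrow> \<not> (x < a \<and> y < b) \<Longrightarrow> w x y = 0"
  unfolding height_arrays_def by blast

lemma height_arrays_mono:
  assumes w: "w \<in> height_arrays a b c" and "x \<le> x'" "x' < a" "y \<le> y'" "y' < b"
  shows "w x y \<le> w x' y'"
proof -
  have "x' < a \<Longrightarrow> w x y \<le> w x' y" using \<open>x \<le> x'\<close>
  proof (induction x' rule: dec_induct)
    case (step n)
    then have "w n y \<le> w (Suc n) y" using w assms(4,5) by (auto simp: height_arrays_def)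
    then show ?case using step by simp
  qed simp
  moreover have "y' < b \<Longrightarrow> w x' y \<le> w x' y'" using \<open>y \<le> y'\<close>
  proof (induction y' rule: dec_induct)
    case (step n)
    then have "w x' n \<le> w x' (Suc n)" using w assms(3) by (auto simp: height_arrays_def)
    then show ?case using step by simp
  qed simp
  ultimately show ?thesis using assms by linarith
qed

lemma height_arraysI:
  assumes "\<And>x y. x < a \<Longrightarrow> y < b \<Longrightarrow> w x y \<le> c"
    and "\<And>x y. Suc x < a \<Longrightarrow> y < b \<Longrightarrow> w x y \<le> w (Suc x) y"
    and "\<And>x y. x < a \<Longrightarrow> Suc y < b \<Longrightarrow> w x y \<le> w x (Suc y)"
    and "\<And>x y. \<not> (x < a \<and> y < b) \<Longrightarrow> w x y = 0"
  shows "w \<in> height_arrays a b c"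
  using assms unfolding height_arrays_def by blast

lemma bij_betw_plane_partitions_height_arrays:
  "bij_betw (\<lambda>P x y. if x < a \<and> y < b then c - nat (P $$ (x, y)) else 0)
     (plane_partitions a b c) (height_arrays a b c)"
proof (rule bij_betwI[where g = "\<lambda>w. mat a b (\<lambda>(x, y). int (c - w x y))"])
  show "(\<lambda>P x y. if x < a \<and> y < b then c - nat (P $$ (x, y)) else 0) \<in>
      plane_partitions a b c \<rightarrow> height_arrays a b c"
  proof
    fix P assume P: "P \<in> plane_partitions a b c"
    show "(\<lambda>x y. if x < a \<and> y < b then c - nat (P $$ (x, y)) else 0) \<in> height_arrays a b c"
    proof (rule height_arraysI)
      fix x y assume "Suc x < a" "y < b"
      then have "P $$ (x, y) \<ge> P $$ (Suc x, y)" using P by (simp add: plane_partitions_def)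
      then show "(if x < a \<and> y < b then c - nat (P $$ (x, y)) else 0)
          \<le> (if Suc x < a \<and> y < b then c - nat (P $$ (Suc x, y)) else 0)"
        using \<open>Suc x < a\<close> \<open>y < b\<close> by auto
    next
      fix x y assume "x < a" "Suc y < b"
      then have "P $$ (x, y) \<ge> P $$ (x, Suc y)" using P by (simp add: plane_partitions_def)
      then show "(if x < a \<and> y < b then c - nat (P $$ (x, y)) else 0)
          \<le> (if x < a \<and> Suc y < b then c - nat (P $$ (x, Suc y)) else 0)"
        using \<open>x < a\<close> \<open>Suc y < b\<close> by auto
    qed auto
  qed
next
  show "(\<lambda>w. mat a b (\<lambda>(x, y). int (c - w x y))) \<in> height_arrays a b c \<rightarrow> plane_partitions a b c"
    by (auto simp: height_arrays_def plane_partitions_def)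
next
  fix P assume P: "P \<in> plane_partitions a b c"
  then have "0 \<le> P $$ (x, y) \<and> P $$ (x, y) \<le> int c" if "x < a" "y < b" for x y
    using that by (simp add: plane_partitions_def)
  then have "int (c - (c - nat (P $$ (x, y)))) = P $$ (x, y)" if "x < a" "y < b" for x y
    using that by (simp add: nat_le_iff)
  then show "mat a b (\<lambda>(x, y). int (c - (if x < a \<and> y < b then c - nat (P $$ (x, y)) else 0))) = P"
    using P by (intro eq_matI) (auto simp: plane_partitions_def)
next
  fix w assume w: "w \<in> height_arrays a b c"
  show "(\<lambda>x y. if x < a \<and> y < b
      then c - nat (mat a b (\<lambda>(x, y). int (c - w x y)) $$ (x, y)) else 0) = w"
    by (intro ext) (use height_arrays_le[OF w] height_arrays_outside[OF w] in \<open>auto simp del: of_nat_diff\<close>)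
qed

section \<open>Cells pushed down their diagonals\<close>

definition diag_shift :: "(nat \<Rightarrow> nat \<Rightarrow> nat) \<Rightarrow> nat \<times> nat \<Rightarrow> nat \<times> nat" where
  "diag_shift w = (\<lambda>(x, y). (x + w x y, y + w x y))"

text \<open>On a fixed diagonal, expressed without subtraction as \<open>x + y' = x' + y\<close>,
  the box order is total. So \<open>w\<close> grows weakly there, and pushing preserves the strict
  order of the cells.\<close>

lemma diag_shift_less:
  assumes w: "w \<in> height_arrays a b c"
    and "x < x'" "x' < a" "y' < b" "x + y' = x' + y"
  shows "x + w x y < x' + w x' y'"
proof -
  have "w x y \<le> w x' y'" by (rule height_arrays_mono[OF w]) (use assms in auto)
  then show ?thesis using assms by simp
qed

lemma diag_shift_eq_imp_diagonal:
  "diag_shift w (x, y) = diag_shift w' (x', y') \<Longrightarrow> x + y' = x' + y"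
  by (auto simp: diag_shift_def)

lemma inj_on_diag_shift:
  assumes w: "w \<in> height_arrays a b c"
  shows "inj_on (diag_shift w) ({..<a} \<times> {..<b})"
proof (rule inj_onI, clarsimp)
  fix x y x' y' assume b: "x < a" "y < b" "x' < a" "y' < b"
    and eq: "diag_shift w (x, y) = diag_shift w (x', y')"
  have d: "x + y' = x' + y" by (rule diag_shift_eq_imp_diagonal[OF eq])
  have "x + w x y = x' + w x' y'" using eq by (simp add: diag_shift_def)
  then have "x = x'"
    using diag_shift_less[OF w _ b(3,4) d] diag_shift_less[OF w _ b(1,2) d[symmetric]]
    by (cases x x' rule: linorder_cases) simp_all
  then show "x = x' \<and> y = y'" using d by simp
qed

lemma strict_mono_on_add_le:
  fixes r :: "nat \<Rightarrow> nat"
  assumes "strict_mono_on {..<k} r" "i \<le> j" "j < k"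
  shows "r i + (j - i) \<le> r j"
  using assms(2,3)
proof (induction j rule: dec_induct)
  case (step n)
  then have "r n < r (Suc n)" using assms(1) by (auto simp: strict_mono_on_def)
  then show ?case using step by simp
qed simp

text \<open>Take the least \<open>t\<close> with \<open>h t \<le> t\<close>. Its predecessor
  \<open>s\<close>, if any, satisfies \<open>s < h s \<le> h t\<close>, whence
  \<open>t \<le> h t\<close>.\<close>

lemma fixed_point_nat:
  fixes h :: "nat \<Rightarrow> nat"
  assumes mono: "\<And>s t. s \<le> t \<Longrightarrow> t \<le> c \<Longrightarrow> h s \<le> h t" and "h c \<le> c"
  shows "\<exists>t\<le>c. h t = t"
proof -
  define t where "t = (LEAST t. h t \<le> t)"
  have le: "h t \<le> t" and "t \<le> c"
    unfolding t_def using \<open>h c \<le> c\<close> by (auto intro: LeastI Least_le)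
  have "t \<le> h t"
  proof (cases t)
    case (Suc s)
    then have "\<not> h s \<le> s" using not_less_Least[of s "\<lambda>t. h t \<le> t"] by (simp add: t_def)
    then show ?thesis using mono[of s t] Suc \<open>t \<le> c\<close> by simp
  qed simp
  with le \<open>t \<le> c\<close> show ?thesis by (intro exI[of _ t]) simp
qed

section \<open>Zero-one matrices described by their zeros\<close>

definition zeros :: "int mat \<Rightarrow> (nat \<times> nat) set" where
  "zeros M = {(i, j). i < dim_row M \<and> j < dim_col M \<and> M $$ (i, j) = 0}"

definition mat_with_zeros :: "nat \<Rightarrow> nat \<Rightarrow> (nat \<times> nat) set \<Rightarrow> int mat" where
  "mat_with_zeros m n Z = mat m n (\<lambda>p. if p \<in> Z then 0 else 1)"

lemma index_mat_with_zeros: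
  "i < m \<Longrightarrow> j < n \<Longrightarrow> mat_with_zeros m n Z $$ (i, j) = (if (i, j) \<in> Z then 0 else 1)"
  by (simp add: mat_with_zeros_def)

lemma mat_with_zeros_in_zero_one_matrices: "mat_with_zeros m n Z \<in> zero_one_matrices m n"
  by (auto simp: mat_with_zeros_def zero_one_matrices_def)

lemma zeros_mat_with_zeros: "Z \<subseteq> {..<m} \<times> {..<n} \<Longrightarrow> zeros (mat_with_zeros m n Z) = Z"
  by (auto simp: mat_with_zeros_def zeros_def split: if_splits)

lemma mat_with_zeros_zeros:
  assumes M: "M \<in> zero_one_matrices m n"
  shows "mat_with_zeros m n (zeros M) = M"
proof -
  have "M $$ (i, j) = 0 \<or> M $$ (i, j) = 1" if "i < m" "j < n" for i j
    using M that by (simp add: zero_one_matrices_def)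
  then show ?thesis
    using M by (intro eq_matI) (auto simp: mat_with_zeros_def zeros_def zero_one_matrices_def)
qed

lemma finite_zeros: "finite (zeros M)"
  by (rule finite_subset[of _ "{..<dim_row M} \<times> {..<dim_col M}"]) (auto simp: zeros_def)

text \<open>Turns maximising the number of ones into minimising the number of zeros.\<close>

lemma num_ones_add_card_zeros:
  assumes "M \<in> zero_one_matrices m n"
  shows "num_ones M + card (zeros M) = m * n"
proof -
  let ?O = "{(i, j). i < dim_row M \<and> j < dim_col M \<and> M $$ (i, j) = 1}"
  have un: "?O \<union> zeros M = {..<m} \<times> {..<n}" and disj: "?O \<inter> zeros M = {}"
    using assms by (auto simp: zeros_def zero_one_matrices_def)
  have "finite (?O \<union> zeros M)" unfolding un by simp
  then have "card (?O \<union> zeros M) = card ?O + card (zeros M)"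
    using disj by (intro card_Un_disjoint) simp_all
  then show ?thesis unfolding num_ones_def un by (simp add: card_cartesian_product)
qed

text \<open>Subtracting \<open>t\<close> from both coordinates of the \<open>t\<close>-th entry of a chain of \<open>c + 1\<close> ones
  gives a weakly increasing sequence of cells of the box, so \<open>w\<close> along it has a fixed point.\<close>

lemma not_contains_identity_diag_shift:
  assumes w: "w \<in> height_arrays a b c"
  shows "\<not> contains_identity (Suc c)
           (mat_with_zeros (a + c) (b + c) (diag_shift w ` ({..<a} \<times> {..<b})))"
proof
  assume "contains_identity (Suc c)
           (mat_with_zeros (a + c) (b + c) (diag_shift w ` ({..<a} \<times> {..<b})))"
  then obtain r s where r: "strict_mono_on {..<Suc c} r" and s: "strict_mono_on {..<Suc c} s"
    and rs: "\<And>i. i < Suc c \<Longrightarrow> r i < a + c \<and> s i < b + c \<and>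
      mat_with_zeros (a + c) (b + c) (diag_shift w ` ({..<a} \<times> {..<b})) $$ (r i, s i) = 1"
    unfolding contains_identity_def by (auto simp: mat_with_zeros_def)
  have one: "r i < a + c \<and> s i < b + c \<and> (r i, s i) \<notin> diag_shift w ` ({..<a} \<times> {..<b})"
    if "i \<le> c" for i
  proof -
    have lt: "r i < a + c" "s i < b + c" using rs[of i] that by simp_all
    show ?thesis using rs[of i] that lt unfolding index_mat_with_zeros[OF lt] by presburger
  qed
  have lower: "t \<le> r t \<and> t \<le> s t" if "t \<le> c" for t
    using strict_mono_on_add_le[OF r, of 0 t] strict_mono_on_add_le[OF s, of 0 t] that by simp
  \<comment> \<open>After index \<open>t\<close> the chain has \<open>c - t\<close> further entries,
    which still have to fit below \<open>a + c\<close> and \<open>b + c\<close>.\<close>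
  have upper: "r t - t < a \<and> s t - t < b" if "t \<le> c" for t
    using strict_mono_on_add_le[OF r, of t c] strict_mono_on_add_le[OF s, of t c] that
      one[of c] lower[OF that] by auto
  have "\<exists>t\<le>c. w (r t - t) (s t - t) = t"
  proof (rule fixed_point_nat)
    fix t t' assume "t \<le> t'" "t' \<le> c"
    then show "w (r t - t) (s t - t) \<le> w (r t' - t') (s t' - t')"
      using strict_mono_on_add_le[OF r, of t t'] strict_mono_on_add_le[OF s, of t t']
        upper[of t'] by (intro height_arrays_mono[OF w]) auto
  qed (rule height_arrays_le[OF w])
  then obtain t where t: "t \<le> c" "w (r t - t) (s t - t) = t" by blast
  \<comment> \<open>At the fixed point the shift by \<open>w\<close> undoes the subtraction of
    \<open>t\<close>, so this entry of the chain is one of the prescribed zeros.\<close>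
  have "(r t, s t) = diag_shift w (r t - t, s t - t)"
    using t lower[of t] by (simp add: diag_shift_def)
  then show False using one[of t] upper[of t] t by blast
qed

section \<open>Chains of ones force \<open>a * b\<close> zeros\<close>

definition has_chain :: "int mat \<Rightarrow> nat \<Rightarrow> nat \<Rightarrow> nat \<Rightarrow> bool" where
  "has_chain M q i j \<longleftrightarrow> (\<exists>r s :: nat \<Rightarrow> nat.
     strict_mono_on {..<q} r \<and> strict_mono_on {..<q} s \<and>
     (\<forall>t<q. r t < i \<and> s t < j \<and> M $$ (r t, s t) = 1))"

lemma contains_identity_iff_has_chain:
  "contains_identity k M \<longleftrightarrow> has_chain M k (dim_row M) (dim_col M)"
  by (simp add: contains_identity_def has_chain_def)

lemma has_chain_0: "has_chain M 0 i j"
  by (simp add: has_chain_def strict_mono_on_def)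

lemma has_chain_mono: "has_chain M q i j \<Longrightarrow> i \<le> i' \<Longrightarrow> j \<le> j' \<Longrightarrow> has_chain M q i' j'"
  unfolding has_chain_def by (meson order_less_le_trans)

text \<open>The bounds in \<open>has_chain\<close> are exclusive, so \<open>(i, j)\<close> lies
  strictly beyond the chain and prolongs it.\<close>

lemma has_chain_Suc:
  assumes "has_chain M q i j" "M $$ (i, j) = 1"
  shows "has_chain M (Suc q) (Suc i) (Suc j)"
proof -
  obtain r s where rs: "strict_mono_on {..<q} r" "strict_mono_on {..<q} s"
    "\<And>t. t < q \<Longrightarrow> r t < i \<and> s t < j \<and> M $$ (r t, s t) = 1"
    using assms(1) unfolding has_chain_def by blast
  have "strict_mono_on {..<Suc q} (r(q := i))" "strict_mono_on {..<Suc q} (s(q := j))"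
    using rs by (auto simp: strict_mono_on_def less_Suc_eq)
  moreover have "\<forall>t<Suc q. (r(q := i)) t < Suc i \<and> (s(q := j)) t < Suc j \<and>
      M $$ ((r(q := i)) t, (s(q := j)) t) = 1"
    using rs(3) assms(2) by (auto simp: less_Suc_eq)
  ultimately show ?thesis unfolding has_chain_def by blast
qed

text \<open>Minimality of \<open>w x y\<close> provides a chain of \<open>w x y\<close> ones
  strictly above and to the left of the pushed cell. A one in that cell would prolong it to a chain
  that the choice of \<open>w x y\<close> excludes.\<close>

lemma avoiding_imp_diag_shift_subset_zeros:
  assumes M: "M \<in> avoiding_matrices (a + c) (b + c) (Suc c)"
  shows "\<exists>w \<in> height_arrays a b c. diag_shift w ` ({..<a} \<times> {..<b}) \<subseteq> zeros M"
proof -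
  define Q where "Q x y t \<longleftrightarrow> \<not> has_chain M (Suc t) (Suc (x + t)) (Suc (y + t))" for x y t
  define w where "w x y = (if x < a \<and> y < b then LEAST t. Q x y t else 0)" for x y
  have dim: "dim_row M = a + c" "dim_col M = b + c"
    using M by (auto simp: avoiding_matrices_def zero_one_matrices_def)
  \<comment> \<open>For \<open>t = c\<close> the bounds stay within the matrix. Avoidance thus makes
    \<open>LEAST\<close> well defined and bounds \<open>w\<close> by \<open>c\<close>.\<close>
  have Qc: "Q x y c" if "x < a" "y < b" for x y
    unfolding Q_def
  proof
    assume "has_chain M (Suc c) (Suc (x + c)) (Suc (y + c))"
    then have "has_chain M (Suc c) (dim_row M) (dim_col M)"
      by (rule has_chain_mono) (use that dim in auto)
    then show False
      using M by (simp add: avoiding_matrices_def contains_identity_iff_has_chain)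
  qed
  \<comment> \<open>\<open>Q\<close> passes from a cell to all cells above and to its left; hence
    the least threshold is monotone.\<close>
  have Q_antimono: "Q x' y' t \<Longrightarrow> x \<le> x' \<Longrightarrow> y \<le> y' \<Longrightarrow> Q x y t" for x y x' y' t
    unfolding Q_def using has_chain_mono[of M "Suc t" "Suc (x + t)" "Suc (y + t)"] by auto
  have Qw: "Q x y (w x y)" if "x < a" "y < b" for x y
    using LeastI[of "Q x y", OF Qc[OF that]] that by (simp add: w_def)
  have w_le: "w x y \<le> t" if "Q x y t" for x y t
    using that by (auto simp: w_def intro: Least_le)
  have "w \<in> height_arrays a b c"
  proof (rule height_arraysI)
    show "w x y \<le> c" if "x < a" "y < b" for x y using w_le Qc that by blast
    show "w x y \<le> w (Suc x) y" if "Suc x < a" "y < b" for x y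
      by (rule w_le, rule Q_antimono[OF Qw[OF that]]) auto
    show "w x y \<le> w x (Suc y)" if "x < a" "Suc y < b" for x y
      by (rule w_le, rule Q_antimono[OF Qw[OF that]]) auto
  qed (auto simp: w_def)
  moreover have "diag_shift w (x, y) \<in> zeros M" if xy: "x < a" "y < b" for x y
  proof -
    define t where "t = w x y"
    have "t \<le> c" unfolding t_def using w_le Qc xy by blast
    have chain: "has_chain M t (x + t) (y + t)"
    proof (cases t)
      case (Suc s)
      then have "\<not> Q x y s" using w_le[of x y s] by (auto simp: t_def)
      then show ?thesis using Suc by (simp add: Q_def)
    qed (simp add: has_chain_0)
    have "M $$ (x + t, y + t) \<noteq> 1"
      using has_chain_Suc[OF chain] Qw[OF xy] by (auto simp: t_def Q_def)
    moreover have "M $$ (x + t, y + t) \<in> {0, 1}"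
      using M xy \<open>t \<le> c\<close> by (simp add: avoiding_matrices_def zero_one_matrices_def)
    ultimately have "M $$ (x + t, y + t) = 0" by blast
    then show ?thesis using xy \<open>t \<le> c\<close> dim by (simp add: diag_shift_def zeros_def t_def)
  qed
  ultimately show ?thesis by blast
qed

text \<open>Induction on rows. If \<open>u x y < v x y\<close> at a cell above which all rows agree,
  the cell hit by \<open>u\<close> from \<open>(x, y)\<close> is hit by \<open>v\<close> from some
  cell of the same diagonal. That cell must lie in an earlier row, as \<open>v\<close> pushes all
  others too far; there \<open>u\<close> and \<open>v\<close> agree, so \<open>u\<close> would hit
  one cell twice.\<close>

lemma diag_shift_image_eq_imp_eq:
  assumes w: "w \<in> height_arrays a b c" and w': "w' \<in> height_arrays a b c"
    and img: "diag_shift w ` ({..<a} \<times> {..<b}) = diag_shift w' ` ({..<a} \<times> {..<b})"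
  shows "w = w'"
proof -
  have not_less: "\<not> u x y < v x y"
    if u: "u \<in> height_arrays a b c" and v: "v \<in> height_arrays a b c"
    and img: "diag_shift u ` ({..<a} \<times> {..<b}) = diag_shift v ` ({..<a} \<times> {..<b})"
    and xy: "x < a" "y < b"
    and IH: "\<And>x' y'. x' < x \<Longrightarrow> y' < b \<Longrightarrow> u x' y' = v x' y'" for u v x y
  proof
    assume less: "u x y < v x y"
    have "diag_shift u (x, y) \<in> diag_shift v ` ({..<a} \<times> {..<b})"
      unfolding img[symmetric] by (rule imageI) (use xy in simp)
    then obtain x' y' where x': "x' < a" "y' < b"
      and eq: "diag_shift u (x, y) = diag_shift v (x', y')" by auto
    have d: "x + y' = x' + y" using diag_shift_eq_imp_diagonal[OF eq] .
    have e: "x + u x y = x' + v x' y'" using eq by (simp add: diag_shift_def)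
    have "x' < x"
    proof (rule ccontr)
      assume "\<not> x' < x"
      then have "v x y \<le> v x' y'" by (intro height_arrays_mono[OF v]) (use d x' in auto)
      then show False using e less \<open>\<not> x' < x\<close> by simp
    qed
    then have "diag_shift u (x, y) = diag_shift u (x', y')"
      using eq IH x' by (simp add: diag_shift_def)
    then show False
      using inj_onD[OF inj_on_diag_shift[OF u], of "(x, y)" "(x', y')"] xy x' \<open>x' < x\<close> by simp
  qed
  have "x < a \<longrightarrow> (\<forall>y<b. w x y = w' x y)" for x
  proof (induction x rule: less_induct)
    case (less x)
    show ?case
    proof (intro impI allI)
      fix y assume xy: "x < a" "y < b"
      have IH: "w x' y' = w' x' y'" if "x' < x" "y' < b" for x' y'
        using less[of x'] that xy by simp
      show "w x y = w' x y"
        using not_less[OF w w' img xy IH] not_less[OF w' w img[symmetric] xy IH[symmetric]]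
        by linarith
    qed
  qed
  then have "w x y = w' x y" for x y
    using height_arrays_outside[OF w, of x y] height_arrays_outside[OF w', of x y]
    by (cases "x < a \<and> y < b") auto
  then show ?thesis by blast
qed

lemma bij_betw_height_arrays_maximal_avoiding_matrices:
  "bij_betw (\<lambda>w. mat_with_zeros (a + c) (b + c) (diag_shift w ` ({..<a} \<times> {..<b})))
     (height_arrays a b c) (maximal_avoiding_matrices (a + c) (b + c) (Suc c))"
proof -
  let ?B = "{..<a} \<times> {..<b}"
  let ?F = "\<lambda>w. mat_with_zeros (a + c) (b + c) (diag_shift w ` ?B)"
  let ?A = "avoiding_matrices (a + c) (b + c) (Suc c)"
  have zeros_F: "zeros (?F w) = diag_shift w ` ?B" if w: "w \<in> height_arrays a b c" for w
  proof (rule zeros_mat_with_zeros, clarsimp simp: diag_shift_def)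
    fix x y assume "x < a" "y < b"
    then show "x + w x y < a + c \<and> y + w x y < b + c"
      using height_arrays_le[OF w, of x y] by simp
  qed
  have card_img: "card (diag_shift w ` ?B) = a * b" if "w \<in> height_arrays a b c" for w
    using inj_on_diag_shift[OF that] by (simp add: card_image)
  have F_avoiding: "?F w \<in> ?A" if "w \<in> height_arrays a b c" for w
    using not_contains_identity_diag_shift[OF that]
    by (simp add: avoiding_matrices_def mat_with_zeros_in_zero_one_matrices)
  have ones: "num_ones M + card (zeros M) = (a + c) * (b + c)" if "M \<in> ?A" for M
    using that by (intro num_ones_add_card_zeros) (simp add: avoiding_matrices_def)
  have card_zeros: "a * b \<le> card (zeros M)" if M: "M \<in> ?A" for M
  proof -
    obtain w where w: "w \<in> height_arrays a b c" and "diag_shift w ` ?B \<subseteq> zeros M"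
      using avoiding_imp_diag_shift_subset_zeros[OF M] by blast
    then have "card (diag_shift w ` ?B) \<le> card (zeros M)" by (intro card_mono finite_zeros)
    then show ?thesis by (simp only: card_img[OF w])
  qed
  show ?thesis
  proof (rule bij_betw_imageI)
    show "inj_on ?F (height_arrays a b c)"
    proof (rule inj_onI)
      fix w w' assume w: "w \<in> height_arrays a b c" and w': "w' \<in> height_arrays a b c"
        and "?F w = ?F w'"
      then have "zeros (?F w) = zeros (?F w')" by (simp only:)
      then show "w = w'"
        unfolding zeros_F[OF w] zeros_F[OF w'] by (rule diag_shift_image_eq_imp_eq[OF w w'])
    qed
    show "?F ` height_arrays a b c = maximal_avoiding_matrices (a + c) (b + c) (Suc c)"
    proof (intro equalityI subsetI)
      fix M assume "M \<in> ?F ` height_arrays a b c"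
      then obtain w where w: "w \<in> height_arrays a b c" and M: "M = ?F w" by blast
      have "M \<in> ?A" "card (zeros M) = a * b"
        unfolding M zeros_F[OF w] by (rule F_avoiding[OF w], rule card_img[OF w])
      then have "num_ones N \<le> num_ones M" if "N \<in> ?A" for N
        using ones[OF that] ones[of M] card_zeros[OF that] by linarith
      with \<open>M \<in> ?A\<close> show "M \<in> maximal_avoiding_matrices (a + c) (b + c) (Suc c)"
        by (simp add: maximal_avoiding_matrices_def)
    next
      fix M assume "M \<in> maximal_avoiding_matrices (a + c) (b + c) (Suc c)"
      then have M: "M \<in> ?A" and max: "\<And>N. N \<in> ?A \<Longrightarrow> num_ones N \<le> num_ones M"
        by (auto simp: maximal_avoiding_matrices_def)
      obtain w where w: "w \<in> height_arrays a b c" and sub: "diag_shift w ` ?B \<subseteq> zeros M"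
        using avoiding_imp_diag_shift_subset_zeros[OF M] by blast
      \<comment> \<open>\<open>?F w\<close> is itself an avoiding competitor with
        \<open>a * b\<close> zeros, so a maximal \<open>M\<close> has no zeros beyond the pushed
        cells.\<close>
      have "card (zeros M) \<le> card (diag_shift w ` ?B)"
        using max[OF F_avoiding[OF w]] ones[OF M] ones[OF F_avoiding[OF w], unfolded zeros_F[OF w]] by linarith
      then have "diag_shift w ` ?B = zeros M"
        using card_seteq[OF finite_zeros sub] by blast
      moreover have "M \<in> zero_one_matrices (a + c) (b + c)"
        using M by (simp add: avoiding_matrices_def)
      ultimately have "?F w = M" by (simp only: mat_with_zeros_zeros)
      then show "M \<in> ?F ` height_arrays a b c" using w by blast
    qed
  qed
qed

section \<open>MacMahon's box formula\<close>

text \<open>Gelfand-Tsetlin patterns whose rows are the antidiagonals \<open>i + j = const\<close>, read in increasing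
  order; adding \<open>j\<close> to each entry has turned one of the two weak interlacing inequalities into a strict one.\<close>

definition patterns :: "nat \<Rightarrow> (nat \<Rightarrow> nat) \<Rightarrow> (nat \<Rightarrow> nat \<Rightarrow> nat) set" where
  "patterns N x = {s.
     (\<forall>j\<le>N. s (N - j) j = x j) \<and>
     (\<forall>i j. i + j < N \<longrightarrow> s (Suc i) j \<le> s i j \<and> s i j < s i (Suc j)) \<and>
     (\<forall>i j. N < i + j \<longrightarrow> s i j = 0)}"

lemma patternsI:
  assumes "\<And>j. j \<le> N \<Longrightarrow> s (N - j) j = x j"
    and "\<And>i j. i + j < N \<Longrightarrow> s (Suc i) j \<le> s i j"
    and "\<And>i j. i + j < N \<Longrightarrow> s i j < s i (Suc j)"
    and "\<And>i j. N < i + j \<Longrightarrow> s i j = 0"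
  shows "s \<in> patterns N x"
  using assms unfolding patterns_def by blast

lemma patternsD:
  assumes "s \<in> patterns N x"
  shows "\<And>j. j \<le> N \<Longrightarrow> s (N - j) j = x j"
    and "\<And>i j. i + j < N \<Longrightarrow> s (Suc i) j \<le> s i j"
    and "\<And>i j. i + j < N \<Longrightarrow> s i j < s i (Suc j)"
    and "\<And>i j. N < i + j \<Longrightarrow> s i j = 0"
  using assms unfolding patterns_def by blast+

lemma patternsD_boundary: "s \<in> patterns N x \<Longrightarrow> i + j = N \<Longrightarrow> s i j = x j"
  using patternsD(1)[of s N x j] by auto

lemma patterns_0: "patterns 0 x = {\<lambda>i j. if i = 0 \<and> j = 0 then x 0 else 0}"
  unfolding patterns_def by (auto simp: fun_eq_iff)

text \<open>Removing the outermost antidiagonal leaves a pattern whose boundary \<open>y\<close> is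
  tied to \<open>x\<close> only by \<open>x j \<le> y j < x (Suc j)\<close>, an independent range
  for each \<open>j\<close>. \<open>restrict\<close> makes \<open>y\<close> extensional, as
  \<open>PiE\<close> demands.\<close>

lemma bij_betw_patterns_Suc:
  "bij_betw (\<lambda>s. (restrict (\<lambda>j. s (N - j) j) {0..<Suc N}, \<lambda>i j. if i + j \<le> N then s i j else 0))
     (patterns (Suc N) x)
     (SIGMA y : PiE {0..<Suc N} (\<lambda>j. {x j..<x (Suc j)}). patterns N y)"
  (is "bij_betw ?f _ ?S")
proof (rule bij_betwI[where g = "\<lambda>(y, t) i j. if i + j = Suc N then x j else t i j"])
  show "?f \<in> patterns (Suc N) x \<rightarrow> ?S"
  proof
    fix s assume s: "s \<in> patterns (Suc N) x"
    have "x j \<le> s (N - j) j \<and> s (N - j) j < x (Suc j)" if "j \<le> N" for j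
      using patternsD(2,3)[OF s, of "N - j" j] patternsD(1)[OF s, of j]
        patternsD(1)[OF s, of "Suc j"] that by (simp add: Suc_diff_le)
    then have "restrict (\<lambda>j. s (N - j) j) {0..<Suc N} \<in> PiE {0..<Suc N} (\<lambda>j. {x j..<x (Suc j)})"
      by auto
    moreover have "(\<lambda>i j. if i + j \<le> N then s i j else 0)
        \<in> patterns N (restrict (\<lambda>j. s (N - j) j) {0..<Suc N})"
      using patternsD[OF s] by (intro patternsI) auto
    ultimately show "?f s \<in> ?S" by simp
  qed
next
  show "(\<lambda>(y, t) i j. if i + j = Suc N then x j else t i j) \<in> ?S \<rightarrow> patterns (Suc N) x"
  proof (clarify)
    fix y t assume y: "y \<in> PiE {0..<Suc N} (\<lambda>j. {x j..<x (Suc j)})" and t: "t \<in> patterns N y"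
    have bd: "x j \<le> t i j \<and> t i j < x (Suc j)" if "i + j = N" for i j
      using PiE_mem[OF y, of j] patternsD_boundary[OF t that] that by simp
    show "(\<lambda>i j. if i + j = Suc N then x j else t i j) \<in> patterns (Suc N) x"
    proof (rule patternsI)
      fix i j assume "i + j < Suc N"
      then consider "i + j = N" | "i + j < N" by linarith
      then show "(if Suc i + j = Suc N then x j else t (Suc i) j) \<le> (if i + j = Suc N then x j else t i j)"
        "(if i + j = Suc N then x j else t i j) < (if i + Suc j = Suc N then x (Suc j) else t i (Suc j))"
        using bd patternsD(2,3)[OF t] by (cases; simp)+
    qed (use patternsD(4)[OF t] in auto)
  qed
next
  fix s assume s: "s \<in> patterns (Suc N) x"
  show "(case ?f s of (y, t) \<Rightarrow> \<lambda>i j. if i + j = Suc N then x j else t i j) = s"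
    using patternsD(4)[OF s] patternsD_boundary[OF s] by (auto simp: fun_eq_iff)
next
  fix p assume "p \<in> ?S"
  then obtain y t where p: "p = (y, t)" and y: "y \<in> PiE {0..<Suc N} (\<lambda>j. {x j..<x (Suc j)})"
    and t: "t \<in> patterns N y" by blast
  have "restrict (\<lambda>j. if N - j + j = Suc N then x j else t (N - j) j) {0..<Suc N} = y"
  proof
    fix j
    show "restrict (\<lambda>j. if N - j + j = Suc N then x j else t (N - j) j) {0..<Suc N} j = y j"
      using patternsD(1)[OF t, of j] PiE_arb[OF y, of j] by (cases "j \<le> N") auto
  qed
  moreover have "(\<lambda>i j. if i + j \<le> N then if i + j = Suc N then x j else t i j else 0) = t"
    using patternsD(4)[OF t] by (auto simp: fun_eq_iff)
  ultimately show "?f (case p of (y, t) \<Rightarrow> \<lambda>i j. if i + j = Suc N then x j else t i j) = p"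
    by (simp only: p prod.case)
qed

lemma finite_patterns: "finite (patterns N x)"
proof (induction N arbitrary: x)
  case (Suc N)
  have "finite (SIGMA y : PiE {0..<Suc N} (\<lambda>j. {x j..<x (Suc j)}). patterns N y)"
    by (intro finite_SigmaI finite_PiE Suc) auto
  then show ?case using bij_betw_finite[OF bij_betw_patterns_Suc] by blast
qed (simp add: patterns_0)

lemma card_patterns_Suc:
  "card (patterns (Suc N) x) =
     (\<Sum>y\<in>PiE {0..<Suc N} (\<lambda>j. {x j..<x (Suc j)}). card (patterns N y))"
proof -
  have "card (SIGMA y : PiE {0..<Suc N} (\<lambda>j. {x j..<x (Suc j)}). patterns N y) =
     (\<Sum>y\<in>PiE {0..<Suc N} (\<lambda>j. {x j..<x (Suc j)}). card (patterns N y))"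
    by (intro card_SigmaI finite_PiE ballI finite_patterns) auto
  then show ?thesis using bij_betw_same_card[OF bij_betw_patterns_Suc] by metis
qed

section \<open>Counting patterns by a binomial determinant\<close>

lemma sum_PiE_det:
  fixes g :: "'b \<Rightarrow> nat \<Rightarrow> 'a :: comm_ring_1"
  assumes "\<And>i. i < n \<Longrightarrow> finite (B i)"
  shows "(\<Sum>y\<in>PiE {0..<n} B. det (mat n n (\<lambda>(i, j). g (y i) j))) =
    det (mat n n (\<lambda>(i, j). \<Sum>t\<in>B i. g t j))"
proof -
  let ?P = "{p. p permutes {0..<n}}"
  have perm: "p i < n" if "p \<in> ?P" "i < n" for p i
    using that permutes_in_image[of p "{0..<n}" i] by simp
  have "(\<Sum>y\<in>PiE {0..<n} B. det (mat n n (\<lambda>(i, j). g (y i) j))) =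
     (\<Sum>y\<in>PiE {0..<n} B. \<Sum>p\<in>?P. signof p * (\<Prod>i = 0..<n. g (y i) (p i)))"
    by (intro sum.cong refl, subst det_def', rule mat_carrier)
       (intro sum.cong refl arg_cong2[where f = "(*)"] prod.cong, use perm in auto)
  also have "\<dots> = (\<Sum>p\<in>?P. signof p * (\<Sum>y\<in>PiE {0..<n} B. \<Prod>i = 0..<n. g (y i) (p i)))"
    by (subst sum.swap) (simp add: sum_distrib_left)
  \<comment> \<open>Multilinearity in the rows: row \<open>i\<close> depends on \<open>y i\<close>
    alone, so the sum over independent choices factors.\<close>
  also have "\<dots> = (\<Sum>p\<in>?P. signof p * (\<Prod>i = 0..<n. \<Sum>t\<in>B i. g t (p i)))"
    by (subst prod_sum_PiE) (use assms in auto)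
  also have "\<dots> = det (mat n n (\<lambda>(i, j). \<Sum>t\<in>B i. g t j))"
    by (subst det_def', rule mat_carrier)
       (intro sum.cong refl arg_cong2[where f = "(*)"] prod.cong, use perm in auto)
  finally show ?thesis .
qed

lemma sum_choose_atLeastLessThan:
  assumes "u \<le> v"
  shows "(\<Sum>t\<in>{u..<v}. real (t choose j)) = real (v choose Suc j) - real (u choose Suc j)"
  using assms by (induction v rule: dec_induct) auto

text \<open>Subtracting from each row the one above it turns the first column, constantly 1, into a
  unit vector; expansion along it leaves the minor. Read from right to left, this absorbs the
  telescoped sums into a determinant one size larger.\<close>

lemma det_choose_Suc:
  "det (mat (Suc n) (Suc n) (\<lambda>(i, j). real (x i choose j))) =
   det (mat n n (\<lambda>(i, j). real (x (Suc i) choose Suc j) - real (x i choose Suc j)))"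
proof -
  let ?n = "Suc n"
  define A where "A = mat ?n ?n (\<lambda>(i, j). real (x i choose j))"
  \<comment> \<open>Left multiplication by the unitriangular \<open>L\<close> performs all row
    subtractions at once.\<close>
  define L where "L = mat ?n ?n (\<lambda>(i, j). (if j = i then 1 else 0) - (if Suc j = i then 1 else (0::real)))"
  define C where "C = mat ?n ?n (\<lambda>(i, j). real (x i choose j) - (if i = 0 then 0 else real (x (i - 1) choose j)))"
  have [simp]: "A \<in> carrier_mat ?n ?n" "L \<in> carrier_mat ?n ?n" "C \<in> carrier_mat ?n ?n"
    by (auto simp: A_def L_def C_def)
  have "L * A = C"
  proof (rule eq_matI)
    fix i j assume "i < dim_row C" "j < dim_col C"
    then have ij: "i < ?n" "j < ?n" by (auto simp: C_def)
    have "(L * A) $$ (i, j) = (\<Sum>k = 0..<?n. L $$ (i, k) * A $$ (k, j))"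
      using ij by (simp add: L_def A_def scalar_prod_def)
    also have "\<dots> = (\<Sum>k = 0..<?n. (if k = i then A $$ (k, j) else 0))
        - (\<Sum>k = 0..<?n. (if Suc k = i then A $$ (k, j) else 0))"
      unfolding sum_subtractf[symmetric] by (rule sum.cong) (use ij in \<open>auto simp: L_def\<close>)
    also have "(\<Sum>k = 0..<?n. (if Suc k = i then A $$ (k, j) else 0)) =
        (if i = 0 then 0 else A $$ (i - 1, j))"
      using ij by (cases i) auto
    also have "(\<Sum>k = 0..<?n. (if k = i then A $$ (k, j) else 0)) = A $$ (i, j)"
      using ij by simp
    finally show "(L * A) $$ (i, j) = C $$ (i, j)"
      using ij by (auto simp: C_def A_def)
  qed (auto simp: C_def L_def A_def)
  moreover have "det L = 1"
    by (subst det_lower_triangular[of ?n], simp_all add: L_def prod_list_diag_prod)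
  ultimately have "det A = det C"
    using det_mult[of L ?n A] by simp
  also have "\<dots> = (\<Sum>i<?n. C $$ (i, 0) * cofactor C i 0)"
    by (rule laplace_expansion_column) auto
  also have "\<dots> = C $$ (0, 0) * cofactor C 0 0"
    by (subst sum.remove[of _ 0]) (auto intro!: sum.neutral simp: C_def)
  also have "\<dots> = det (mat_delete C 0 0)"
    by (simp add: C_def cofactor_def)
  also have "mat_delete C 0 0 =
      mat n n (\<lambda>(i, j). real (x (Suc i) choose Suc j) - real (x i choose Suc j))"
    by (rule eq_matI) (auto simp: mat_delete_def C_def)
  finally show ?thesis by (simp add: A_def)
qed

lemma card_patterns_eq_det:
  assumes "\<And>j. j < N \<Longrightarrow> x j \<le> x (Suc j)"
  shows "real (card (patterns N x)) = det (mat (Suc N) (Suc N) (\<lambda>(i, j). real (x i choose j)))"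
  using assms
proof (induction N arbitrary: x)
  case 0
  have "det (mat 1 1 (\<lambda>(i, j). real (x i choose j))) = 1"
    by (subst det_single) auto
  then show ?case by (simp add: patterns_0)
next
  case (Suc N)
  let ?Y = "PiE {0..<Suc N} (\<lambda>j. {x j..<x (Suc j)})"
  have IH: "real (card (patterns N y)) = det (mat (Suc N) (Suc N) (\<lambda>(i, j). real (y i choose j)))"
    if y: "y \<in> ?Y" for y
  proof (rule Suc.IH)
    fix j assume "j < N"
    \<comment> \<open>The ranges of \<open>y j\<close> and \<open>y (Suc j)\<close> are separated by
      \<open>x (Suc j)\<close>.\<close>
    then show "y j \<le> y (Suc j)" using PiE_mem[OF y, of j] PiE_mem[OF y, of "Suc j"] by simp
  qed
  have "real (card (patterns (Suc N) x)) = (\<Sum>y\<in>?Y. real (card (patterns N y)))"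
    by (simp add: card_patterns_Suc)
  also have "\<dots> = (\<Sum>y\<in>?Y. det (mat (Suc N) (Suc N) (\<lambda>(i, j). real (y i choose j))))"
    by (rule sum.cong) (auto simp: IH)
  also have "\<dots> = det (mat (Suc N) (Suc N) (\<lambda>(i, j). \<Sum>t\<in>{x i..<x (Suc i)}. real (t choose j)))"
    by (rule sum_PiE_det) simp
  also have "mat (Suc N) (Suc N) (\<lambda>(i, j). \<Sum>t\<in>{x i..<x (Suc i)}. real (t choose j)) =
     mat (Suc N) (Suc N) (\<lambda>(i, j). real (x (Suc i) choose Suc j) - real (x i choose Suc j))"
    by (rule eq_matI) (auto simp: sum_choose_atLeastLessThan Suc.prems)
  finally show ?case by (simp only: det_choose_Suc)
qed

section \<open>Evaluation of the binomial determinant\<close>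

lemma Suc_times_choose_Suc:
  "real (Suc j) * real (t choose Suc j) = (real t - real j) * real (t choose j)"
proof (cases "j \<le> t")
  case True
  have "Suc j * (t choose Suc j) = (t - j) * (t choose j)"
    using binomial_absorb_comp[of t j] Suc_times_binomial_eq[of "t - 1" j] True
    by (cases t) (auto simp: mult.commute)
  then show ?thesis using True by (metis of_nat_diff of_nat_mult)
qed (simp add: binomial_eq_0)

text \<open>As a polynomial in \<open>t\<close>, the binomial has degree \<open>j\<close> and
  leading coefficient \<open>1 / fact j\<close>, so it expands at arbitrary nodes, possibly
  repeated. The vanishing for \<open>l > j\<close> later makes the coefficient matrix upper
  triangular.\<close>

lemma choose_newton_expansion:
  fixes z :: "nat \<Rightarrow> real"
  shows "\<exists>u. u j = 1 / fact j \<and> (\<forall>l>j. u l = 0) \<and>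
    (\<forall>t. real (t choose j) = (\<Sum>l\<le>j. u l * (\<Prod>s<l. (real t - z s))))"
proof (induction j)
  case 0
  show ?case by (intro exI[of _ "\<lambda>l. if l = 0 then 1 else 0"]) auto
next
  case (Suc j)
  then obtain u where u: "u j = 1 / fact j" "\<And>l. l > j \<Longrightarrow> u l = 0"
    "\<And>t. real (t choose j) = (\<Sum>l\<le>j. u l * (\<Prod>s<l. (real t - z s)))" by blast
  \<comment> \<open>Split \<open>t - j\<close> as \<open>(t - z l) + (z l - j)\<close>: the first
    summand lengthens the Newton product by a factor, the second only rescales it. The divisor comes
    from \<open>Suc_times_choose_Suc\<close>.\<close>
  define v where "v l = ((if l = 0 then 0 else u (l - 1)) + u l * (z l - real j)) / real (Suc j)" for l
  have "real (t choose Suc j) = (\<Sum>l\<le>Suc j. v l * (\<Prod>s<l. (real t - z s)))" for t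
  proof -
    let ?q = "\<lambda>l. \<Prod>s<l. (real t - z s)"
    have "real (Suc j) * real (t choose Suc j) = (\<Sum>l\<le>j. (real t - real j) * (u l * ?q l))"
      unfolding Suc_times_choose_Suc u(3) by (rule sum_distrib_left)
    also have "\<dots> = (\<Sum>l\<le>j. u l * ?q (Suc l)) + (\<Sum>l\<le>j. u l * (z l - real j) * ?q l)"
      unfolding sum.distrib[symmetric] by (rule sum.cong) (auto simp: algebra_simps)
    also have "(\<Sum>l\<le>j. u l * ?q (Suc l)) = (\<Sum>l\<le>Suc j. (if l = 0 then 0 else u (l - 1)) * ?q l)"
      by (simp add: sum.atMost_Suc_shift del: sum.atMost_Suc)
    also have "(\<Sum>l\<le>j. u l * (z l - real j) * ?q l) = (\<Sum>l\<le>Suc j. u l * (z l - real j) * ?q l)"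
      by (simp add: u(2))
    also have "(\<Sum>l\<le>Suc j. (if l = 0 then 0 else u (l - 1)) * ?q l) +
        (\<Sum>l\<le>Suc j. u l * (z l - real j) * ?q l) = (\<Sum>l\<le>Suc j. real (Suc j) * (v l * ?q l))"
      unfolding sum.distrib[symmetric]
      by (rule sum.cong) (auto simp: v_def field_simps simp del: of_nat_Suc)
    finally show ?thesis
      unfolding sum_distrib_left[symmetric] by (simp del: of_nat_Suc)
  qed
  moreover have "v (Suc j) = 1 / fact (Suc j)" "\<forall>l>Suc j. v l = 0"
    using u(1,2) by (auto simp: v_def mult.commute simp del: of_nat_Suc)
  ultimately show ?case by blast
qed

lemma fact_eq_prod_diff: "(fact n :: real) = (\<Prod>l<n. (real n - real l))"
proof -
  have "(\<Prod>l<n. (real n - real l)) = (\<Prod>l<n. real (Suc l))"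
    by (subst prod.nat_diff_reindex[symmetric]) (auto intro!: prod.cong)
  then show ?thesis by (simp add: fact_prod_Suc atLeast0LessThan)
qed

text \<open>With the points \<open>x i\<close> as nodes, the Newton product at \<open>(i, j)\<close>
  contains the zero factor \<open>s = i\<close> whenever \<open>i < j\<close>. The matrix is
  therefore a lower triangular \<open>A\<close> times an upper triangular \<open>U\<close>, and only
  the diagonals matter.\<close>

lemma det_choose:
  "det (mat n n (\<lambda>(i, j). real (x i choose j))) =
     (\<Prod>i<n. \<Prod>l<i. (real (x i) - real (x l)) / (real i - real l))"
proof -
  obtain u where u: "\<And>j. u j j = 1 / fact j" "\<And>j l. l > j \<Longrightarrow> u j l = 0"
    "\<And>j t. real (t choose j) = (\<Sum>l\<le>j. u j l * (\<Prod>s<l. (real t - real (x s))))"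
    using choose_newton_expansion[of _ "\<lambda>s. real (x s)"] by metis
  define A where "A = mat n n (\<lambda>(i, j). \<Prod>s<j. (real (x i) - real (x s)))"
  define U where "U = mat n n (\<lambda>(l, j). u j l)"
  have [simp]: "A \<in> carrier_mat n n" "U \<in> carrier_mat n n" by (auto simp: A_def U_def)
  have "mat n n (\<lambda>(i, j). real (x i choose j)) = A * U"
  proof (rule eq_matI)
    fix i j assume "i < dim_row (A * U)" "j < dim_col (A * U)"
    then have ij: "i < n" "j < n" by (auto simp: A_def U_def)
    have "(A * U) $$ (i, j) = (\<Sum>l = 0..<n. (\<Prod>s<l. (real (x i) - real (x s))) * u j l)"
      using ij by (simp add: A_def U_def scalar_prod_def)
    also have "\<dots> = (\<Sum>l\<le>j. (\<Prod>s<l. (real (x i) - real (x s))) * u j l)"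
      by (rule sum.mono_neutral_right) (use ij u(2) in auto)
    also have "\<dots> = real (x i choose j)" by (simp add: u(3) mult.commute)
    finally show "mat n n (\<lambda>(i, j). real (x i choose j)) $$ (i, j) = (A * U) $$ (i, j)"
      using ij by simp
  qed (auto simp: A_def U_def)
  moreover have "det A = (\<Prod>i<n. \<Prod>s<i. (real (x i) - real (x s)))"
    by (subst det_lower_triangular[of n]) (auto simp: A_def prod_list_diag_prod atLeast0LessThan)
  moreover have "det U = (\<Prod>i<n. 1 / fact i)"
    by (subst det_upper_triangular[of _ n])
       (auto simp: U_def prod_list_diag_prod atLeast0LessThan u upper_triangular_def)
  ultimately show ?thesis
    using det_mult[of A n U]
    by (simp add: prod.distrib[symmetric] prod_dividef fact_eq_prod_diff)
qed

section \<open>The box as a pattern with top row \<open>(c^a, 0^b)\<close>, read increasingly and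
  shifted by the index\<close>

definition boundary :: "nat \<Rightarrow> nat \<Rightarrow> nat \<Rightarrow> nat" where
  "boundary b c j = (if j < b then j else c + j)"

text \<open>Pairs of indices on the same side of \<open>b\<close> contribute 1. A mixed pair
  contributes the telescoped product over \<open>l\<close> in \<open>H\<close>.\<close>

lemma prod_boundary_eq_H:
  "(\<Prod>i<a + b. \<Prod>l<i. (real (boundary b c i) - real (boundary b c l)) / (real i - real l)) = H a b c"
proof -
  let ?g = "\<lambda>i l. (real (boundary b c i) - real (boundary b c l)) / (real i - real l)"
  have split: "prod f {..<d + e} = prod f {..<d} * (\<Prod>i<e. f (d + i))" for f :: "nat \<Rightarrow> real" and d e
    by (induction e) (auto simp: mult.assoc)
  have low: "(\<Prod>i<b. \<Prod>l<i. ?g i l) = 1"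
    by (intro prod.neutral ballI) (auto simp: boundary_def)
  have high: "(\<Prod>l<b + i. ?g (b + i) l) = (\<Prod>l<b. real (i + l + 1 + c) / real (i + l + 1))" for i
  proof -
    have "(\<Prod>l<b + i. ?g (b + i) l) = (\<Prod>l<b. ?g (b + i) l) * (\<Prod>l<i. ?g (b + i) (b + l))"
      by (rule split)
    also have "(\<Prod>l<i. ?g (b + i) (b + l)) = 1"
      by (intro prod.neutral ballI) (auto simp: boundary_def)
    \<comment> \<open>Counting the low block downwards from \<open>b - 1\<close> makes the factors
      depend on \<open>i + l\<close> only, as in \<open>H\<close>.\<close>
    also have "(\<Prod>l<b. ?g (b + i) l) = (\<Prod>l<b. ?g (b + i) (b - Suc l))"
      by (rule prod.nat_diff_reindex[symmetric])
    also have "\<dots> = (\<Prod>l<b. real (i + l + 1 + c) / real (i + l + 1))"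
      by (rule prod.cong) (auto simp: boundary_def algebra_simps)
    finally show ?thesis by simp
  qed
  have tele: "(\<Prod>l=1..c. (real (Suc i) + real (Suc j) + real l - 1) / (real (Suc i) + real (Suc j) + real l - 2))
      = real (i + j + 1 + c) / real (i + j + 1)" for i j
    by (induction c) (auto simp: field_simps)
  have "(\<Prod>i<a + b. \<Prod>l<i. ?g i l) = (\<Prod>i<a. \<Prod>l<b. real (i + l + 1 + c) / real (i + l + 1))"
    using split[of "\<lambda>i. \<Prod>l<i. ?g i l" b a] low high by (simp add: add.commute)
  also have "\<dots> = H a b c"
    unfolding H_def One_nat_def
    by (subst prod.atLeast1_atMost_eq, rule prod.cong[OF refl],
        subst prod.atLeast1_atMost_eq, rule prod.cong[OF refl],
        rule tele[unfolded One_nat_def, symmetric])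
  finally show ?thesis .
qed

text \<open>For \<open>x = boundary b c\<close> and \<open>N = a + b - 1\<close> these bounds meet
  at \<open>j\<close> when \<open>a \<le> i\<close> and at \<open>c + j\<close> when
  \<open>i < a\<close> and \<open>b \<le> j\<close>. Only the \<open>a\<close> by \<open>b\<close>
  rectangle is left free, with values from \<open>j\<close> to \<open>c + j\<close>.\<close>

lemma patterns_less_boundary:
  assumes s: "s \<in> patterns N x" and "i + j \<le> N"
  shows "s i j + (N - i - j) \<le> x (N - i)" and "j \<le> s i j" and "x j \<le> s i j"
proof -
  have row: "s i j + d \<le> s i (j + d)" if "i + j + d \<le> N" for i j d
    using that
  proof (induction d)
    case (Suc d)
    then show ?case using patternsD(3)[OF s, of i "j + d"] by simp
  qed simp
  have col: "s (i + d) j \<le> s i j" if "i + j + d \<le> N" for d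
    using that
  proof (induction d)
    case (Suc d)
    then show ?case using patternsD(2)[OF s, of "i + d" j] by simp
  qed simp
  show "s i j + (N - i - j) \<le> x (N - i)"
    using row[of i j "N - i - j"] patternsD_boundary[OF s, of i "N - i"] assms(2) by simp
  show "j \<le> s i j" using row[of i 0 j] assms(2) by simp
  show "x j \<le> s i j"
    using col[of "N - i - j"] patternsD_boundary[OF s, of "N - j" j] assms(2) by simp
qed

text \<open>Row indices are reversed by \<open>a - 1 - i\<close>, because pattern entries fall with
  \<open>i\<close> while heights rise with \<open>x\<close>. Outside the rectangle the entries are
  the forced ones.\<close>

lemma bij_betw_height_arrays_patterns:
  assumes "0 < a" "0 < b"
  shows "bij_betw (\<lambda>w i j. if i + j < a + b
       then if a \<le> i then j else if b \<le> j then c + j else w (a - 1 - i) j + j else 0)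
     (height_arrays a b c) (patterns (a + b - 1) (boundary b c))"
  (is "bij_betw ?f _ (patterns ?N ?x)")
proof (rule bij_betwI[where g = "\<lambda>s x y. if x < a \<and> y < b then s (a - 1 - x) y - y else 0"])
  show "?f \<in> height_arrays a b c \<rightarrow> patterns ?N ?x"
  proof
    fix w assume w: "w \<in> height_arrays a b c"
    note le = height_arrays_le[OF w]
    show "?f w \<in> patterns ?N ?x"
    proof (rule patternsI)
      fix j assume "j \<le> ?N"
      then show "?f w (?N - j) j = ?x j" using assms by (auto simp: boundary_def)
    next
      fix i j assume ij: "i + j < ?N"
      have "w (a - 1 - Suc i) j \<le> w (a - 1 - i) j" if "Suc i < a" "j < b"
        by (rule height_arrays_mono[OF w]) (use that in auto)
      then show "?f w (Suc i) j \<le> ?f w i j" using ij by auto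
      have "w (a - 1 - i) j \<le> w (a - 1 - i) (Suc j)" if "i < a" "Suc j < b"
        by (rule height_arrays_mono[OF w]) (use that in auto)
      then show "?f w i j < ?f w i (Suc j)" using ij le[of "a - 1 - i" j]
        by (auto simp: less_Suc_eq_le)
    qed (use assms in auto)
  qed
next
  show "(\<lambda>s x y. if x < a \<and> y < b then s (a - 1 - x) y - y else 0)
      \<in> patterns ?N ?x \<rightarrow> height_arrays a b c"
  proof
    fix s assume s: "s \<in> patterns ?N ?x"
    show "(\<lambda>x y. if x < a \<and> y < b then s (a - 1 - x) y - y else 0) \<in> height_arrays a b c"
    proof (rule height_arraysI)
      fix x y assume xy: "x < a" "y < b"
      then have "a - 1 - x + y \<le> ?N" by simp
      from patterns_less_boundary(1)[OF s this] xy
      show "(if x < a \<and> y < b then s (a - 1 - x) y - y else 0) \<le> c"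
        by (auto simp: boundary_def)
    next
      fix x y assume xy: "Suc x < a" "y < b"
      then have "s (Suc (a - 1 - Suc x)) y \<le> s (a - 1 - Suc x) y"
        by (intro patternsD(2)[OF s]) auto
      moreover have "Suc (a - 1 - Suc x) = a - 1 - x" using xy by simp
      ultimately show "(if x < a \<and> y < b then s (a - 1 - x) y - y else 0)
          \<le> (if Suc x < a \<and> y < b then s (a - 1 - Suc x) y - y else 0)"
        using xy by simp
    next
      fix x y assume xy: "x < a" "Suc y < b"
      then have "s (a - 1 - x) y < s (a - 1 - x) (Suc y)"
        by (intro patternsD(3)[OF s]) auto
      then show "(if x < a \<and> y < b then s (a - 1 - x) y - y else 0)
          \<le> (if x < a \<and> Suc y < b then s (a - 1 - x) (Suc y) - Suc y else 0)"
        using xy by simp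
    qed auto
  qed
next
  fix w assume "w \<in> height_arrays a b c"
  then show "(\<lambda>x y. if x < a \<and> y < b then ?f w (a - 1 - x) y - y else 0) = w"
    by (auto simp: fun_eq_iff height_arrays_def)
next
  fix s assume s: "s \<in> patterns ?N ?x"
  show "?f (\<lambda>x y. if x < a \<and> y < b then s (a - 1 - x) y - y else 0) = s"
  proof (intro ext)
    fix i j
    show "?f (\<lambda>x y. if x < a \<and> y < b then s (a - 1 - x) y - y else 0) i j = s i j"
    proof (cases "i + j < a + b")
      case True
      then have ij: "i + j \<le> ?N" by simp
      note lb = patterns_less_boundary[OF s ij]
      consider "a \<le> i" | "i < a" "b \<le> j" | "i < a" "j < b" by linarith
      \<comment> \<open>In the first two cases the bounds \<open>lb\<close> determine the entry; in
        the third, \<open>j \<le> s i j\<close> makes subtracting and adding \<open>j\<close>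
        cancel.\<close>
      then show ?thesis
        using True lb ij by cases (auto simp: boundary_def split: if_splits)
    next
      case False
      then show ?thesis using patternsD(4)[OF s, of i j] assms by simp
    qed
  qed
qed

theorem card_plane_partitions:
  assumes "0 < a" "0 < b"
  shows "real (card (plane_partitions a b c)) = H a b c"
proof -
  have "card (plane_partitions a b c) = card (patterns (a + b - 1) (boundary b c))"
    using bij_betw_same_card[OF bij_betw_plane_partitions_height_arrays]
      bij_betw_same_card[OF bij_betw_height_arrays_patterns[OF assms]] by simp
  also have "real \<dots> = det (mat (Suc (a + b - 1)) (Suc (a + b - 1)) (\<lambda>(i, j). real (boundary b c i choose j)))"
    by (rule card_patterns_eq_det) (simp add: boundary_def)
  also have "\<dots> = H a b c"
    unfolding det_choose using assms by (simp add: prod_boundary_eq_H)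
  finally show ?thesis .
qed

theorem theorem1p1:
  fixes m n k :: nat
  assumes "2 \<le> k" and "k \<le> min m n"
  shows "(\<exists>f. bij_betw f (maximal_avoiding_matrices m n k)
                (plane_partitions (m - k + 1) (n - k + 1) (k - 1))) \<and>
         real (card (maximal_avoiding_matrices m n k)) = H (m - k + 1) (n - k + 1) (k - 1)"
proof -
  \<comment> \<open>\<open>k \<le> min m n\<close> makes the subtractions exact, and the added 1
    makes \<open>a\<close> and \<open>b\<close> positive, as \<open>card_plane_partitions\<close>
    requires.\<close>
  define a b c where "a = m - k + 1" and "b = n - k + 1" and "c = k - 1"
  have eqs: "m = a + c" "n = b + c" "k = Suc c" using assms by (auto simp: a_def b_def c_def)
  obtain f where f: "bij_betw f (maximal_avoiding_matrices m n k) (plane_partitions a b c)"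
    unfolding eqs
    using bij_betw_trans[OF bij_betw_inv_into[OF bij_betw_height_arrays_maximal_avoiding_matrices]
        bij_betw_inv_into[OF bij_betw_plane_partitions_height_arrays]] by blast
  then have "real (card (maximal_avoiding_matrices m n k)) = H a b c"
    using bij_betw_same_card[OF f] card_plane_partitions[of a b c] by (simp add: a_def b_def)
  with f show ?thesis unfolding a_def b_def c_def by blast
qed

end
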